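(* Let $N$ be a positive even integer, $h=2\pi/N$, and $\tau>0$. Let $D$ and $A$ be the linear operators on $N$-periodic complex grid functions $\mathbf{u}=(u_1,\dots,u_N)^T$ (with $u_{j+N}=u_j$) given by $$(D\mathbf{u})_j=\frac{u_{j+1}-2u_j+u_{j-1}}{h^2},\qquad (A\mathbf{u})_j=\frac{u_{j+1}-u_{j-1}}{2h}.$$ Consider the fully discrete central scheme with ETD-RK1 time stepping $$\mathbf{u}^{n+1}=e^{\tau D}\mathbf{u}^n-D^{-1}\left(e^{\tau D}-I\right)A\mathbf{u}^n .$$ If $\tau\le 2$, then the scheme is stable, with growth factor satisfying $|\widehat{G}(\tau,h,\omega)|\le 1$ for all $\omega\in\{-\frac N2+1,\dots,\frac N2\}$.
   Context: The scheme discretizes the dimensionless advection-diffusion equation $u_t+u_x=u_{xx}$ with periodic boundary condition on a uniform grid. Convention: $D^{-1}(e^{\tau D}-I)$ denotes $\tau\varphi_1(\tau D)$, where $\varphi_1(z)=(e^z-1)/z$ is the entire function with $\varphi_1(0)=1$. Thus if $D\mathbf v=\lambda\mathbf v$, then $D^{-1}(e^{\tau D}-I)\mathbf v=\lambda^{-1}(e^{\tau\lambda}-1)\mathbf v$, read as $\tau\mathbf v$ when $\lambda=0$. Growth factor: for an integer $\omega\in\{-\frac N2+1,\dots,\frac N2\}$ the Fourier mode $u_j^n=\widehat u^n e^{\mathrm i\omega jh}$, $j=1,\dots,N$, is a common eigenvector of $D$ and $A$, and the scheme maps it to $\mathbf u^{n+1}=\widehat G(\tau,h,\omega)\mathbf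 u^n$; the scalar $\widehat G(\tau,h,\omega)$ is the growth factor, explicitly $$\widehat{G}(\tau,h,\omega)=e^{-\frac{4\tau}{h^2}\sin^2(\frac{\omega h}{2})}+\mathrm i\frac{h}{2}\cot\left(\frac{\omega h}{2}\right)\left(e^{-\frac{4\tau}{h^2}\sin^2(\frac{\omega h}{2})}-1\right),$$ read as its limit $1$ at $\omega=0$. Stability means $|\widehat G(\tau,h,\omega)|\le1$ for all such $\omega$. *)

theory Defs
  imports Complex_Main
begin

text \<open>
  Grid functions are functions on the integers; the vector \<open>(u\<^sub>1, \<dots>, u\<^sub>N)\<close> with \<open>u\<^sub>j\<^sub>+\<^sub>N = u\<^sub>j\<close> is
  an element of \<open>grid N\<close>. The operators below are written for arbitrary functions on the integers
  and leave \<open>grid N\<close> invariant.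
\<close>

type_synonym gridfun = "int \<Rightarrow> complex"

definition grid :: "nat \<Rightarrow> gridfun set" where
  "grid N = {u. \<forall>j. u (j + int N) = u j}"

definition diff_op :: "real \<Rightarrow> gridfun \<Rightarrow> gridfun" where
  "diff_op h u j = (u (j + 1) - 2 * u j + u (j - 1)) / (complex_of_real h)\<^sup>2"

definition adv_op :: "real \<Rightarrow> gridfun \<Rightarrow> gridfun" where
  "adv_op h u j = (u (j + 1) - u (j - 1)) / (2 * complex_of_real h)"

definition scale_op :: "real \<Rightarrow> (gridfun \<Rightarrow> gridfun) \<Rightarrow> gridfun \<Rightarrow> gridfun" where
  "scale_op t L u j = complex_of_real t * L u j"

text \<open>
  The functions \<open>e\<^sup>z\<close> and \<open>\<phi>\<^sub>1(z) = (e\<^sup>z - 1) / z\<close> of a linear operator, by their power series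
  \<open>\<Sum>k. z\<^sup>k / k!\<close> and \<open>\<Sum>k. z\<^sup>k / (k + 1)!\<close>. For \<open>diff_op\<close> on periodic grid functions, the
  series converge absolutely at every grid point (lemmas \<open>summable_exp_op\<close>, \<open>summable_phi1_op\<close>).
\<close>

definition exp_op :: "(gridfun \<Rightarrow> gridfun) \<Rightarrow> gridfun \<Rightarrow> gridfun" where
  "exp_op L u j = (\<Sum>k. (L ^^ k) u j / fact k)"

definition phi1_op :: "(gridfun \<Rightarrow> gridfun) \<Rightarrow> gridfun \<Rightarrow> gridfun" where
  "phi1_op L u j = (\<Sum>k. (L ^^ k) u j / fact (Suc k))"

text \<open>\<open>D\<^sup>-\<^sup>1 (e\<^sup>\<tau>\<^sup>D - I)\<close> stands for \<open>\<tau> \<phi>\<^sub>1(\<tau> D)\<close>, as \<open>D\<close> itself is singular.\<close>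

definition etd_rk1_step :: "real \<Rightarrow> real \<Rightarrow> gridfun \<Rightarrow> gridfun" where
  "etd_rk1_step \<tau> h u j =
     exp_op (scale_op \<tau> (diff_op h)) u j
     - complex_of_real \<tau> * phi1_op (scale_op \<tau> (diff_op h)) (adv_op h u) j"

definition fourier_mode :: "real \<Rightarrow> int \<Rightarrow> gridfun" where
  "fourier_mode h \<omega> j = exp (\<i> * of_int \<omega> * of_int j * complex_of_real h)"

definition wavenumbers :: "nat \<Rightarrow> int set" where
  "wavenumbers N = {- (int N div 2) + 1 .. int N div 2}"

text \<open>
  Since \<open>fourier_mode h \<omega>\<close> has no zeros, at most one \<open>g\<close> satisfies the following predicate.
\<close>

definition is_growth_factor ::
  "nat \<Rightarrow> real \<Rightarrow> (gridfun \<Rightarrow> gridfun) \<Rightarrow> int \<Rightarrow> complex \<Rightarrow> bool" where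
  "is_growth_factor N h \<Phi> \<omega> g \<longleftrightarrow>
     (\<forall>c. (\<lambda>j. c * fourier_mode h \<omega> j) \<in> grid N \<and>
          \<Phi> (\<lambda>j. c * fourier_mode h \<omega> j) = (\<lambda>j. g * (c * fourier_mode h \<omega> j)))"

definition stable_scheme :: "nat \<Rightarrow> real \<Rightarrow> (gridfun \<Rightarrow> gridfun) \<Rightarrow> bool" where
  "stable_scheme N h \<Phi> \<longleftrightarrow>
     (\<forall>\<omega>\<in>wavenumbers N. \<exists>g. is_growth_factor N h \<Phi> \<omega> g \<and> cmod g \<le> 1)"

text \<open>The value at \<open>\<omega> = 0\<close> is the limit of the formula, in which the cotangent has a pole.\<close>

definition growth_factor :: "real \<Rightarrow> real \<Rightarrow> int \<Rightarrow> complex" where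
  "growth_factor \<tau> h \<omega> =
     (if \<omega> = 0 then 1
      else let E = exp (- (4 * \<tau> / h\<^sup>2) * (sin (of_int \<omega> * h / 2))\<^sup>2)
           in complex_of_real E
              + \<i> * complex_of_real (h / 2 * cot (of_int \<omega> * h / 2) * (E - 1)))"

lemma gridD: "u \<in> grid N \<Longrightarrow> u (j + int N) = u j"
  by (simp add: grid_def)

lemma grid_diff_op: "u \<in> grid N \<Longrightarrow> diff_op h u \<in> grid N"
proof -
  assume u: "u \<in> grid N"
  have "u (j + int N + 1) = u (j + 1)" "u (j + int N - 1) = u (j - 1)" "u (j + int N) = u j" for j
    using gridD[OF u, of "j + 1"] gridD[OF u, of "j - 1"] gridD[OF u, of j]
    by (simp_all add: algebra_simps)
  then show ?thesis by (simp add: grid_def diff_op_def)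
qed

lemma grid_adv_op: "u \<in> grid N \<Longrightarrow> adv_op h u \<in> grid N"
proof -
  assume u: "u \<in> grid N"
  have "u (j + int N + 1) = u (j + 1)" "u (j + int N - 1) = u (j - 1)" for j
    using gridD[OF u, of "j + 1"] gridD[OF u, of "j - 1"] gridD[OF u, of j]
    by (simp_all add: algebra_simps)
  then show ?thesis by (simp add: grid_def adv_op_def)
qed

lemma grid_scale_op: "L u \<in> grid N \<Longrightarrow> scale_op t L u \<in> grid N"
  by (simp add: grid_def scale_op_def)

lemma grid_scale_diff_op_funpow:
  "u \<in> grid N \<Longrightarrow> (scale_op \<tau> (diff_op h) ^^ k) u \<in> grid N"
  by (induction k) (simp_all add: grid_scale_op grid_diff_op)

lemma grid_etd_rk1_step:
  assumes "u \<in> grid N"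
  shows "etd_rk1_step \<tau> h u \<in> grid N"
proof -
  have "(scale_op \<tau> (diff_op h) ^^ k) v (j + int N) = (scale_op \<tau> (diff_op h) ^^ k) v j"
    if "v \<in> grid N" for v k j
    using gridD[OF grid_scale_diff_op_funpow[OF that]] .
  from this[OF assms] this[OF grid_adv_op[OF assms]] show ?thesis
    unfolding grid_def etd_rk1_step_def exp_op_def phi1_op_def by simp
qed

lemma grid_bounded:
  assumes "u \<in> grid N" "N > 0"
  obtains B where "\<And>j. norm (u j) \<le> B"
proof -
  have step: "u (j + int n * int N) = u j" for j n
  proof (induction n)
    case (Suc n)
    have "u (j + int (Suc n) * int N) = u ((j + int n * int N) + int N)"
      by (simp add: algebra_simps)
    also have "\<dots> = u j" using assms(1) Suc by (simp add: grid_def)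
    finally show ?case .
  qed simp
  have red: "u j = u (j mod int N)" for j
  proof (cases "j div int N \<ge> 0")
    case True
    then show ?thesis using step[of "j mod int N" "nat (j div int N)"] by simp
  next
    case False
    then show ?thesis using step[of j "nat (- (j div int N))"]
      by (simp add: minus_div_mult_eq_mod)
  qed
  have "norm (u j) \<le> Max ((\<lambda>j. norm (u j)) ` {0..<int N})" for j
    by (subst red, rule Max_ge) (use assms(2) in auto)
  then show ?thesis using that by blast
qed

lemma norm_scale_diff_op_funpow:
  assumes B: "\<And>j. norm (u j) \<le> B"
  shows "norm ((scale_op \<tau> (diff_op h) ^^ k) u j) \<le> (4 * \<bar>\<tau>\<bar> / h\<^sup>2) ^ k * B"
proof (induction k arbitrary: j)
  case (Suc k)
  let ?v = "(scale_op \<tau> (diff_op h) ^^ k) u" and ?M = "(4 * \<bar>\<tau>\<bar> / h\<^sup>2) ^ k * B"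
  have "norm (?v (j + 1) - 2 * ?v j + ?v (j - 1))
      \<le> norm (?v (j + 1)) + 2 * norm (?v j) + norm (?v (j - 1))"
    using norm_triangle_ineq[of "?v (j + 1) - 2 * ?v j" "?v (j - 1)"]
      norm_triangle_ineq4[of "?v (j + 1)" "2 * ?v j"] by (simp add: norm_mult)
  also have "\<dots> \<le> 4 * ?M" using Suc.IH[of "j + 1"] Suc.IH[of j] Suc.IH[of "j - 1"] by simp
  finally have *: "norm (?v (j + 1) - 2 * ?v j + ?v (j - 1)) \<le> 4 * ?M" .
  have "norm ((scale_op \<tau> (diff_op h) ^^ Suc k) u j)
      = \<bar>\<tau>\<bar> / h\<^sup>2 * norm (?v (j + 1) - 2 * ?v j + ?v (j - 1))"
    by (simp add: scale_op_def diff_op_def norm_mult norm_divide norm_power)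
  also have "\<dots> \<le> \<bar>\<tau>\<bar> / h\<^sup>2 * (4 * ?M)"
    by (rule mult_left_mono[OF *]) simp
  finally show ?case by (simp add: mult_ac)
qed (simp add: B)

lemma
  assumes "u \<in> grid N" "N > 0"
  shows summable_exp_op:
      "summable (\<lambda>k. norm ((scale_op \<tau> (diff_op h) ^^ k) u j / fact k))"
    and summable_phi1_op:
      "summable (\<lambda>k. norm ((scale_op \<tau> (diff_op h) ^^ k) u j / fact (Suc k)))"
proof -
  obtain B where B: "\<And>j. norm (u j) \<le> B" using grid_bounded[OF assms] by blast
  let ?c = "4 * \<bar>\<tau>\<bar> / h\<^sup>2" and ?v = "\<lambda>k. (scale_op \<tau> (diff_op h) ^^ k) u j"
  have s: "summable (\<lambda>k. ?c ^ k * B / fact k)"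
    using summable_mult[OF summable_exp[of ?c], of B] by (simp add: field_simps)
  have le: "norm (?v k / fact k) \<le> ?c ^ k * B / fact k" for k
    using norm_scale_diff_op_funpow[where \<tau> = \<tau> and h = h and k = k and j = j, OF B]
    by (simp add: norm_divide divide_right_mono)
  have le': "norm (?v k / fact (Suc k)) \<le> norm (?v k / fact k)" for k
    unfolding norm_divide norm_fact
    by (rule divide_left_mono) (auto intro!: fact_mono mult_pos_pos simp del: fact_Suc)
  show "summable (\<lambda>k. norm (?v k / fact k))"
    by (rule summable_comparison_test'[OF s, of 0]) (use le in simp)
  then show "summable (\<lambda>k. norm (?v k / fact (Suc k)))"
    by (rule summable_comparison_test'[of _ 0]) (use le' in \<open>simp del: fact_Suc\<close>)
qed

lemma phi1_series:
  fixes z :: complex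
  shows "(\<lambda>k. z ^ k / fact (Suc k)) sums (if z = 0 then 1 else (exp z - 1) / z)"
proof (cases "z = 0")
  case True
  then show ?thesis using powser_sums_zero[of "\<lambda>k. 1 / fact (Suc k) :: complex"] by simp
next
  case False
  have "(\<lambda>k. z ^ k / fact k) sums exp z"
    using exp_converges[of z] by (simp add: scaleR_conv_of_real field_simps)
  then have "(\<lambda>k. z ^ Suc k / fact (Suc k)) sums (exp z - 1)"
    by (subst sums_Suc_iff) simp
  from sums_divide[OF this, of z] False show ?thesis by (simp del: fact_Suc)
qed

end

theory Submission
  imports Defs
begin

text \<open>
  Fourier modes are common eigenvectors of all the operators involved, which yields the explicit
  growth factor. With \<open>\<theta> = \<omega> h / 2\<close> and \<open>a = 4 \<tau> sin\<^sup>2 \<theta> / h\<^sup>2\<close>, the inequality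
  \<open>\<bar>G\<bar>\<^sup>2 \<le> 1\<close> amounts to \<open>h\<^sup>2 / 4 \<cdot> cot\<^sup>2 \<theta> \<cdot> tanh (a / 2) \<le> 1\<close>. Since \<open>tanh (a / 2) \<le> a / 2\<close>,
  the left-hand side is at most \<open>\<tau> cos\<^sup>2 \<theta> / 2 \<le> 1\<close>.
\<close>

text \<open>\<open>L\<close> need not be linear: homogeneity along the line spanned by
  \<open>v\<close> suffices, because the induction absorbs \<open>\<mu> ^ k\<close> into the scalar.
  Hence the premise ranges over all \<open>c\<close>.\<close>

lemma funpow_eigen:
  fixes L :: "gridfun \<Rightarrow> gridfun"
  assumes "\<And>c. L (\<lambda>j. c * v j) = (\<lambda>j. \<mu> * (c * v j))"
  shows "(L ^^ k) (\<lambda>j. c * v j) = (\<lambda>j. \<mu> ^ k * (c * v j))"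
proof (induction k)
  case (Suc k)
  have "(L ^^ Suc k) (\<lambda>j. c * v j) = L (\<lambda>j. (\<mu> ^ k * c) * v j)"
    by (simp add: Suc.IH mult.assoc)
  also have "\<dots> = (\<lambda>j. \<mu> ^ Suc k * (c * v j))"
    by (simp only: assms) (simp add: mult_ac)
  finally show ?case .
qed simp

lemma exp_op_eigen:
  assumes "\<And>c. L (\<lambda>j. c * v j) = (\<lambda>j. \<mu> * (c * v j))"
  shows "exp_op L (\<lambda>j. c * v j) = (\<lambda>j. exp \<mu> * (c * v j))"
proof
  fix j
  have "(\<lambda>k. \<mu> ^ k / fact k) sums exp \<mu>"
    using exp_converges[of \<mu>] by (simp add: scaleR_conv_of_real field_simps)
  from sums_mult2[OF this, of "c * v j"]
  show "exp_op L (\<lambda>j. c * v j) j = exp \<mu> * (c * v j)"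
    by (simp add: exp_op_def funpow_eigen[OF assms] sums_iff)
qed

lemma phi1_op_eigen:
  assumes "\<And>c. L (\<lambda>j. c * v j) = (\<lambda>j. \<mu> * (c * v j))"
  shows "phi1_op L (\<lambda>j. c * v j) = (\<lambda>j. (if \<mu> = 0 then 1 else (exp \<mu> - 1) / \<mu>) * (c * v j))"
proof
  fix j
  from sums_mult2[OF phi1_series[of \<mu>], of "c * v j"]
  show "phi1_op L (\<lambda>j. c * v j) j = (if \<mu> = 0 then 1 else (exp \<mu> - 1) / \<mu>) * (c * v j)"
    by (simp add: phi1_op_def funpow_eigen[OF assms] sums_iff del: fact_Suc)
qed

lemma fourier_mode_shift:
  "fourier_mode h \<omega> (j + 1) = cis (of_int \<omega> * h) * fourier_mode h \<omega> j"
  "fourier_mode h \<omega> (j - 1) = cis (- (of_int \<omega> * h)) * fourier_mode h \<omega> j"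
  unfolding fourier_mode_def cis_conv_exp exp_add[symmetric]
  by (rule arg_cong[of _ _ exp], simp add: algebra_simps)+

text \<open>Since N h = 2 pi, a shift by N adds a multiple of 2 pi i to the exponent.\<close>

lemma fourier_mode_grid:
  assumes "N > 0" "h = 2 * pi / real N"
  shows "(\<lambda>j. c * fourier_mode h \<omega> j) \<in> grid N"
proof -
  have "fourier_mode h \<omega> (j + int N) = fourier_mode h \<omega> j" for j
  proof -
    have "complex_of_real h * of_nat N = 2 * of_real pi"
      using assms by simp
    then have "\<i> * of_int \<omega> * of_int (j + int N) * complex_of_real h
        = \<i> * of_int \<omega> * of_int j * complex_of_real h + of_int (2 * \<omega>) * of_real pi * \<i>"
      by (simp add: algebra_simps)
    moreover have "exp (of_int (2 * \<omega>) * of_real pi * \<i>) = 1"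
      using cis_multiple_2pi[of "of_int \<omega>"] by (simp add: cis_conv_exp mult_ac)
    ultimately show ?thesis
      by (simp only: fourier_mode_def exp_add) simp
  qed
  then show ?thesis by (simp add: grid_def)
qed

lemma scale_diff_op_fourier_mode:
  "scale_op \<tau> (diff_op h) (\<lambda>j. c * fourier_mode h \<omega> j)
    = (\<lambda>j. of_real (- (4 * \<tau> / h\<^sup>2) * (sin (of_int \<omega> * h / 2))\<^sup>2) * (c * fourier_mode h \<omega> j))"
proof
  fix j
  let ?t = "of_int \<omega> * h :: real"
  have "cis ?t - 2 + cis (- ?t) = of_real (- 4 * (sin (?t / 2))\<^sup>2)"
    using cos_double_sin[of "?t / 2"] by (simp add: complex_eq_iff)
  \<comment> \<open>The flipped equation turns the real eigenvalue back into its \<open>cis\<close>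
    form, so that both sides are expressed by the same two shifts of the mode.\<close>
  then have "scale_op \<tau> (diff_op h) (\<lambda>j. c * fourier_mode h \<omega> j) j
      = of_real \<tau> * (of_real (- 4 * (sin (?t / 2))\<^sup>2) * (c * fourier_mode h \<omega> j) / (of_real h)\<^sup>2)"
    by (simp only: scale_op_def diff_op_def fourier_mode_shift flip: \<open>_ = of_real _\<close>)
      (simp add: algebra_simps)
  then show "scale_op \<tau> (diff_op h) (\<lambda>j. c * fourier_mode h \<omega> j) j
      = of_real (- (4 * \<tau> / h\<^sup>2) * (sin (?t / 2))\<^sup>2) * (c * fourier_mode h \<omega> j)"
    by simp
qed

text \<open>The eigenvalue is grouped with \<open>c\<close>, so that the result is visibly a scalar
  multiple of the mode and \<open>phi1_op_eigen\<close> applies to it directly.\<close>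

lemma adv_op_fourier_mode:
  "adv_op h (\<lambda>j. c * fourier_mode h \<omega> j)
    = (\<lambda>j. (\<i> * of_real (sin (of_int \<omega> * h) / h) * c) * fourier_mode h \<omega> j)"
proof
  fix j
  let ?t = "of_int \<omega> * h :: real"
  have "cis ?t - cis (- ?t) = 2 * \<i> * of_real (sin ?t)"
    by (simp add: complex_eq_iff)
  then have "adv_op h (\<lambda>j. c * fourier_mode h \<omega> j) j
      = 2 * \<i> * of_real (sin ?t) * (c * fourier_mode h \<omega> j) / (2 * of_real h)"
    by (simp only: adv_op_def fourier_mode_shift flip: \<open>_ = 2 * _ * _\<close>)
      (simp add: algebra_simps)
  then show "adv_op h (\<lambda>j. c * fourier_mode h \<omega> j) j
      = (\<i> * of_real (sin ?t / h) * c) * fourier_mode h \<omega> j"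
    by simp
qed

lemma etd_rk1_step_fourier_mode:
  assumes "h \<noteq> 0" "\<tau> \<noteq> 0" and nz: "\<omega> \<noteq> 0 \<Longrightarrow> sin (of_int \<omega> * h / 2) \<noteq> 0"
  shows "etd_rk1_step \<tau> h (\<lambda>j. c * fourier_mode h \<omega> j)
    = (\<lambda>j. growth_factor \<tau> h \<omega> * (c * fourier_mode h \<omega> j))"
proof
  fix j
  let ?s = "sin (of_int \<omega> * h / 2)" and ?c = "cos (of_int \<omega> * h / 2)"
  define z where "z = - (4 * \<tau> / h\<^sup>2) * ?s\<^sup>2"
  \<comment> \<open>This is phi_1 at the eigenvalue \<open>z\<close> of tau D, including its value 1
    at the removable singularity.\<close>
  define p where "p = (if complex_of_real z = 0 then 1 else (exp (complex_of_real z) - 1) / of_real z)"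
  note eigen = scale_diff_op_fourier_mode[of \<tau> h _ \<omega>, folded z_def]
  have step: "etd_rk1_step \<tau> h (\<lambda>j. c * fourier_mode h \<omega> j) j
      = (exp (of_real z) - of_real \<tau> * p * (\<i> * of_real (sin (of_int \<omega> * h) / h)))
        * (c * fourier_mode h \<omega> j)"
    unfolding etd_rk1_step_def adv_op_fourier_mode
    by (simp only: exp_op_eigen[OF eigen] phi1_op_eigen[OF eigen] p_def)
      (simp only: algebra_simps)
  have "exp (of_real z) - of_real \<tau> * p * (\<i> * of_real (sin (of_int \<omega> * h) / h))
      = growth_factor \<tau> h \<omega>"
  proof (cases "\<omega> = 0")
    case True
    \<comment> \<open>For constant modes both \<open>z\<close> and the advection eigenvalue vanish,
      which leaves \<open>exp 0\<close>.\<close>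
    then show ?thesis by (simp add: growth_factor_def z_def)
  next
    case False
    then have s: "?s \<noteq> 0" and "z \<noteq> 0" using nz assms by (auto simp: z_def)
    then have p: "p = of_real ((exp z - 1) / z)" by (simp add: p_def exp_of_real)
    have "\<tau> * ((exp z - 1) / z) * (sin (of_int \<omega> * h) / h)
        = - (h / 2 * cot (of_int \<omega> * h / 2) * (exp z - 1))"
    proof -
      have "sin (of_int \<omega> * h) = 2 * ?s * ?c"
        using sin_double[of "of_int \<omega> * h / 2"] by simp
      \<comment> \<open>Here \<open>\<tau> / z\<close> equals - h^2 / (4 sin^2), so the time step
        cancels and one sine survives in the denominator: this is the origin of the
        cotangent.\<close>
      moreover have "\<tau> / z * (2 * ?s * ?c / h) = - (h / 2 * (?c / ?s))"
        using s assms by (simp add: z_def field_simps power2_eq_square)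
      moreover have "\<tau> * ((exp z - 1) / z) * (2 * ?s * ?c / h)
          = \<tau> / z * (2 * ?s * ?c / h) * (exp z - 1)" by simp
      ultimately show ?thesis by (simp add: cot_def)
    qed
    then have "of_real \<tau> * p * of_real (sin (of_int \<omega> * h) / h)
        = complex_of_real (- (h / 2 * cot (of_int \<omega> * h / 2) * (exp z - 1)))"
      unfolding p by (metis of_real_mult)
    moreover have "of_real \<tau> * p * (\<i> * of_real (sin (of_int \<omega> * h) / h))
        = \<i> * (of_real \<tau> * p * of_real (sin (of_int \<omega> * h) / h))" by simp
    moreover have "growth_factor \<tau> h \<omega>
        = of_real (exp z) + \<i> * of_real (h / 2 * cot (of_int \<omega> * h / 2) * (exp z - 1))"
      using False by (simp only: growth_factor_def z_def Let_def if_False)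
    ultimately show ?thesis by (simp add: exp_of_real)
  qed
  with step show "etd_rk1_step \<tau> h (\<lambda>j. c * fourier_mode h \<omega> j) j
      = growth_factor \<tau> h \<omega> * (c * fourier_mode h \<omega> j)" by simp
qed

text \<open>This is \<open>tanh (a / 2) \<le> a / 2\<close> with denominators cleared.\<close>

lemma one_minus_exp_neg_le:
  fixes a :: real
  assumes "a \<ge> 0"
  shows "2 * (1 - exp (- a)) \<le> a * (1 + exp (- a))"
proof -
  define f where "f x = x * (1 + exp (- x)) - 2 * (1 - exp (- x))" for x :: real
  have "(f has_real_derivative 1 - (1 + x) * exp (- x)) (at x)" for x
    unfolding f_def by (auto intro!: derivative_eq_intros simp: algebra_simps)
  \<comment> \<open>Nonnegativity of the derivative is \<open>1 + x \<le> exp x\<close> in disguise;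
    the claim follows from monotonicity because \<open>f 0 = 0\<close>.\<close>
  moreover have "(1 + x) * exp (- x) \<le> 1" for x :: real
    using exp_ge_add_one_self[of x] by (simp add: exp_minus field_simps)
  ultimately have "f 0 \<le> f a"
    by (intro DERIV_nonneg_imp_nondecreasing[OF assms]) (metis diff_ge_0_iff_ge)
  then show ?thesis by (simp add: f_def)
qed

lemma cmod_growth_factor_le_1:
  assumes "h \<noteq> 0" "0 \<le> \<tau>" "\<tau> \<le> 2"
  shows "cmod (growth_factor \<tau> h \<omega>) \<le> 1"
proof (cases "\<omega> = 0 \<or> sin (of_int \<omega> * h / 2) = 0")
  case True
  \<comment> \<open>If the sine vanishes, the exponential is 1, which kills the imaginary part and
    leaves the factor 1.\<close>
  then show ?thesis by (auto simp: growth_factor_def)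
next
  case False
  let ?s = "sin (of_int \<omega> * h / 2)" and ?c = "cos (of_int \<omega> * h / 2)"
  from False have s: "?s \<noteq> 0" and \<omega>: "\<omega> \<noteq> 0" by auto
  define a where "a = 4 * \<tau> / h\<^sup>2 * ?s\<^sup>2"
  define E where "E = exp (- a)"
  define b where "b = h / 2 * cot (of_int \<omega> * h / 2)"
  have a: "a \<ge> 0" using assms by (simp add: a_def)
  then have E: "0 < E" "E \<le> 1" by (simp_all add: E_def)
  \<comment> \<open>The powers of h and of the sine cancel, which is why the bound on the time step
    is independent of the mesh. The next step is where \<open>\<tau> \<le> 2\<close> enters.\<close>
  have "b\<^sup>2 * a = \<tau> * ?c\<^sup>2"
    using s assms by (simp add: b_def a_def cot_def power_mult_distrib power_divide)
  also have "\<dots> \<le> 2 * 1"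
    using assms by (intro mult_mono) (simp_all add: abs_square_le_1)
  finally have ba: "b\<^sup>2 * a \<le> 2" by simp
  have "2 * (b\<^sup>2 * (1 - E)) \<le> b\<^sup>2 * a * (1 + E)"
    using mult_left_mono[OF one_minus_exp_neg_le[OF a], of "b\<^sup>2"] by (simp add: E_def algebra_simps)
  also have "\<dots> \<le> 2 * (1 + E)"
    using ba E by (intro mult_right_mono) auto
  \<comment> \<open>Multiplying by \<open>1 - E\<close>, which is nonnegative, completes the square
    on the left and gives \<open>1 - E\<^sup>2\<close> on the right.\<close>
  finally have "b\<^sup>2 * (1 - E) * (1 - E) \<le> (1 + E) * (1 - E)"
    using E by (intro mult_right_mono) auto
  then have "E\<^sup>2 + (b * (E - 1))\<^sup>2 \<le> 1"
    by (simp add: power2_eq_square algebra_simps)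
  moreover have "growth_factor \<tau> h \<omega> = Complex E (b * (E - 1))"
    using \<omega> by (simp add: growth_factor_def Let_def E_def a_def b_def complex_eq_iff)
  ultimately show ?thesis by (simp add: cmod_def)
qed

text \<open>A zero of the sine would force N to divide \<omega>, whereas 0 < |\<omega>| \<le> N/2 <
  N. This keeps the cotangent away from its poles.\<close>

lemma sin_wavenumber_nonzero:
  assumes "N > 0" "h = 2 * pi / real N" "\<omega> \<in> wavenumbers N" "\<omega> \<noteq> 0"
  shows "sin (of_int \<omega> * h / 2) \<noteq> 0"
proof
  assume "sin (of_int \<omega> * h / 2) = 0"
  then obtain k :: int where "of_int \<omega> * h / 2 = of_int k * pi"
    by (auto simp: sin_zero_iff_int2)
  then have "real_of_int \<omega> = of_int (k * int N)"
    using assms(1,2) by (simp add: field_simps)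
  then have "\<omega> = k * int N" by (simp only: of_int_eq_iff)
  then have "int N dvd \<omega>" by simp
  then have "int N \<le> \<bar>\<omega>\<bar>" using assms(4) dvd_imp_le_int[of \<omega> "int N"] by simp
  moreover have "\<bar>\<omega>\<bar> \<le> int N div 2" using assms(3) by (auto simp: wavenumbers_def)
  ultimately show False using assms(1) by linarith
qed

theorem theorem3p1:
  fixes N :: nat and h \<tau> :: real
  assumes "N > 0" and "even N" and "h = 2 * pi / real N"
    and "\<tau> > 0" and "\<tau> \<le> 2"
  shows "stable_scheme N h (etd_rk1_step \<tau> h) \<and>
    (\<forall>\<omega>\<in>wavenumbers N.
       is_growth_factor N h (etd_rk1_step \<tau> h) \<omega> (growth_factor \<tau> h \<omega>) \<and>
       cmod (growth_factor \<tau> h \<omega>) \<le> 1)"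
proof -
  have h: "h \<noteq> 0" using assms(1,3) by simp
  have "is_growth_factor N h (etd_rk1_step \<tau> h) \<omega> (growth_factor \<tau> h \<omega>)"
    if "\<omega> \<in> wavenumbers N" for \<omega>
    using fourier_mode_grid[OF assms(1,3)] etd_rk1_step_fourier_mode[OF h]
      sin_wavenumber_nonzero[OF assms(1,3) that] assms(4)
    by (simp add: is_growth_factor_def)
  moreover have "cmod (growth_factor \<tau> h \<omega>) \<le> 1" for \<omega>
    using cmod_growth_factor_le_1[OF h] assms(4,5) by simp
  ultimately show ?thesis unfolding stable_scheme_def by blast
qed

end
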